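(* For any graph $G$ we have $\mathrm{ed}(G)\le \mathrm{gd}(G)-1$.
   Context: Graphs are finite, simple and undirected, with nonempty vertex set. For $G=([n],E)$, the Gram dimension $\mathrm{gd}(G)$ is the smallest integer $k\ge 1$ such that for every real symmetric positive semidefinite $n\times n$ matrix $X$ there exists a positive semidefinite $n\times n$ matrix $X'$ of rank at most $k$ with $X'_{ii}=X_{ii}$ for all $i\in[n]$ and $X'_{ij}=X_{ij}$ for all $ij\in E$. For $d\in\mathbb R_+^E$, a Euclidean representation of $d$ in $\mathbb R^k$ is a set of vectors $p_1,\dots,p_n\in\mathbb R^k$ with $\|p_i-p_j\|^2=d_{ij}$ for all $ij\in E$. $\mathrm{EDM}(G)$ is the set of $d\in\mathbb R_+^E$ having a Euclidean representation in some $\mathbb R^k$. For $d\in \mathrm{EDM}(G)$, $\mathrm{ed}(G,d)$ is the smallest integer $k\ge 0$ for which $d$ has a Euclidean representation in $\mathbb R^k$ (with $\mathbb R^0=\{0\}$), and $\mathrm{ed}(G)=\max_{d\in \mathrm{EDM}(G)}\mathrm{ed}(G,d)$. *)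

theory Defs
  imports "HOL-Analysis.Analysis"
begin

text \<open>
  The vertex set \<open>[n]\<close> is the index type \<open>'n::finite\<close>, which is nonempty like every type.
  A graph is given by its edge set; an edge is a two-element vertex set, so that the value of an
  edge vector \<open>d\<close> at the edge \<open>ij\<close> is \<open>d {i, j}\<close>.
\<close>

definition simple_graph :: "'n::finite set set \<Rightarrow> bool" where
  "simple_graph E \<longleftrightarrow> (\<forall>e\<in>E. card e = 2)"

definition psd :: "real ^ 'n ^ 'n::finite \<Rightarrow> bool" where
  "psd X \<longleftrightarrow> transpose X = X \<and> (\<forall>x. 0 \<le> x \<bullet> (X *v x))"

definition gram_dim :: "'n::finite set set \<Rightarrow> nat" where
  "gram_dim E = (LEAST k. 1 \<le> k \<and>
     (\<forall>X :: real ^ 'n ^ 'n. psd X \<longrightarrow>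
       (\<exists>X' :: real ^ 'n ^ 'n. psd X' \<and> rank X' \<le> k \<and>
          (\<forall>i. X' $ i $ i = X $ i $ i) \<and>
          (\<forall>i j. {i, j} \<in> E \<longrightarrow> X' $ i $ j = X $ i $ j))))"

text \<open>
  Since \<open>k\<close> varies, \<open>\<real>\<^sup>k\<close> is the carrier of \<^const>\<open>Euclidean_space\<close>: the sequences
  \<open>nat \<Rightarrow> real\<close> vanishing at all indices \<open>\<ge> k\<close>. Its norm is \<open>\<lambda>x. L2_set x {..<k}\<close>.
\<close>

definition euclidean_rep ::
    "'n::finite set set \<Rightarrow> ('n set \<Rightarrow> real) \<Rightarrow> nat \<Rightarrow> ('n \<Rightarrow> nat \<Rightarrow> real) \<Rightarrow> bool" where
  "euclidean_rep E d k p \<longleftrightarrow>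
     (\<forall>i. p i \<in> topspace (Euclidean_space k)) \<and>
     (\<forall>i j. {i, j} \<in> E \<longrightarrow> (L2_set (\<lambda>l. p i l - p j l) {..<k})\<^sup>2 = d {i, j})"

definition EDM :: "'n::finite set set \<Rightarrow> ('n set \<Rightarrow> real) set" where
  "EDM E = {d \<in> E \<rightarrow>\<^sub>E {0..}. \<exists>k p. euclidean_rep E d k p}"

definition euclid_dim_at :: "'n::finite set set \<Rightarrow> ('n set \<Rightarrow> real) \<Rightarrow> nat" where
  "euclid_dim_at E d = (LEAST k. \<exists>p. euclidean_rep E d k p)"

text \<open>
  For a graph on \<open>n\<close> vertices the set below is nonempty, as it contains the value at \<open>d = 0\<close>,
  and bounded by \<open>n - 1\<close>, so the maximum exists.
\<close>

definition euclid_dim :: "'n::finite set set \<Rightarrow> nat" where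
  "euclid_dim E = Max (euclid_dim_at E ` EDM E)"

text \<open>The next lemma shows that the minimum defining \<^const>\<open>gram_dim\<close> is attained.\<close>

lemma gram_dim_wellposed:
  fixes E :: "'n::finite set set"
  shows "\<exists>k\<ge>1. \<forall>X :: real ^ 'n ^ 'n. psd X \<longrightarrow>
           (\<exists>X' :: real ^ 'n ^ 'n. psd X' \<and> rank X' \<le> k \<and>
              (\<forall>i. X' $ i $ i = X $ i $ i) \<and>
              (\<forall>i j. {i, j} \<in> E \<longrightarrow> X' $ i $ j = X $ i $ j))"
proof (intro exI conjI allI impI)
  show "1 \<le> CARD('n)" by (simp add: Suc_leI)
  fix X :: "real ^ 'n ^ 'n"
  show "rank X \<le> CARD('n)" using rank_bound[of X] by simp
qed auto

end

theory Submission
  imports Defs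
begin

text \<open>
  Let \<open>k = gram_dim E\<close>, let \<open>p\<close> represent \<open>d\<close>, and lift each \<open>p i\<close> to \<open>(p i, t)\<close>.
  By definition of \<open>k\<close> the lifted vectors can be replaced by vectors \<open>u i\<close> in \<open>\<real>\<^sup>k\<close> of the same
  norms and with the same inner products, hence the same distances, along the edges.
  As \<open>t\<close> grows, each connected component stays in a bounded region of an almost flat piece of a
  sphere of radius about \<open>t\<close>. Projecting the vectors of each component onto the orthogonal
  complement of the vector of a root of that component therefore distorts the edge lengths by
  \<open>O(1/t\<^sup>2)\<close> only, and by compactness a limit of these projections represents \<open>d\<close> in \<open>\<real>\<^sup>k\<^sup>-\<^sup>1\<close>.
\<close>

section \<open>Positive semidefinite matrices, Schur complements and Gram factorization\<close>

lemma psd_component_commute: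
  assumes "psd X"
  shows "X $ i $ j = X $ j $ i"
proof -
  have "transpose X $ i $ j = X $ i $ j" using assms by (simp add: psd_def)
  then show ?thesis by (simp add: transpose_def)
qed

lemma psd_nonneg: "psd X \<Longrightarrow> 0 \<le> x \<bullet> (X *v x)"
  by (simp add: psd_def)

lemma matrix_axis_component: "((X :: real ^ 'n ^ 'm::finite) *v axis j 1) $ i = X $ i $ j"
  by (simp add: matrix_vector_mult_basis column_def)

lemma psd_diag_nonneg:
  assumes "psd X"
  shows "0 \<le> X $ i $ i"
  using psd_nonneg[OF assms, of "axis i 1"]
  by (simp add: inner_axis' matrix_axis_component)

text \<open>With a zero diagonal, the quadratic form takes the values \<open>2 * X $ i $ j\<close>
  and \<open>- 2 * X $ i $ j\<close> at the sum and the difference of two unit vectors.\<close>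

lemma psd_zero_diag:
  assumes "psd X" and diag: "\<And>i. X $ i $ i = 0"
  shows "X $ i $ j = 0"
proof -
  have sym: "X $ j $ i = X $ i $ j" by (rule psd_component_commute[OF assms(1)])
  have "0 \<le> (axis i 1 + axis j 1) \<bullet> (X *v (axis i 1 + axis j 1))"
    and "0 \<le> (axis i 1 - axis j 1) \<bullet> (X *v (axis i 1 - axis j 1))"
    by (rule psd_nonneg[OF assms(1)])+
  then show ?thesis
    by (simp add: matrix_vector_right_distrib matrix_vector_mult_diff_distrib inner_add_left
        inner_diff_left inner_axis' matrix_axis_component diag sym)
qed

text \<open>
  The Schur complement of the \<open>r\<close>-th diagonal entry, kept at full size. If \<open>X\<close> is the Gram matrix
  of vectors \<open>u\<close>, it is the Gram matrix of their projections onto the orthogonal complement of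
  \<open>u r\<close>.
\<close>

definition schur_complement :: "real ^ 'n ^ 'n::finite \<Rightarrow> 'n \<Rightarrow> real ^ 'n ^ 'n" where
  "schur_complement X r = (\<chi> i j. X $ i $ j - X $ i $ r * X $ j $ r / X $ r $ r)"

text \<open>Both positive semidefiniteness and the rank drop rest on this: \<open>x\<close> is
  corrected along \<open>axis r 1\<close> so that, when \<open>X $ r $ r\<close> is nonzero, the
  \<open>r\<close>-th coordinate of its image vanishes.\<close>

lemma schur_complement_mult:
  assumes "psd X"
  shows "schur_complement X r *v x = X *v (x - ((X *v x) $ r / X $ r $ r) *\<^sub>R axis r 1)"
proof (rule vec_eq_iff[THEN iffD2], rule allI)
  fix i
  have "(schur_complement X r *v x) $ i =
      (\<Sum>j\<in>UNIV. (X $ i $ j - X $ i $ r * X $ j $ r / X $ r $ r) * x $ j)"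
    by (simp add: schur_complement_def matrix_vector_mult_def)
  also have "\<dots> = (\<Sum>j\<in>UNIV. X $ i $ j * x $ j - X $ i $ r / X $ r $ r * (X $ r $ j * x $ j))"
  proof (rule sum.cong)
    fix j
    have "X $ j $ r = X $ r $ j" by (rule psd_component_commute[OF assms])
    then show "(X $ i $ j - X $ i $ r * X $ j $ r / X $ r $ r) * x $ j =
        X $ i $ j * x $ j - X $ i $ r / X $ r $ r * (X $ r $ j * x $ j)"
      by (simp only:) (simp add: left_diff_distrib)
  qed simp
  also have "\<dots> = (X *v x) $ i - X $ i $ r / X $ r $ r * (X *v x) $ r"
    by (simp add: matrix_vector_mult_def sum_subtractf sum_distrib_left)
  finally show "(schur_complement X r *v x) $ i =
      (X *v (x - ((X *v x) $ r / X $ r $ r) *\<^sub>R axis r 1)) $ i"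
    by (simp add: matrix_vector_mult_diff_distrib matrix_vector_mult_scaleR matrix_axis_component)
qed

lemma schur_complement_mult_component:
  assumes "psd X" "X $ r $ r \<noteq> 0"
  shows "(schur_complement X r *v x) $ r = 0"
  using assms(2)
  by (simp add: schur_complement_mult[OF assms(1)] matrix_vector_mult_diff_distrib
      matrix_vector_mult_scaleR matrix_axis_component)

lemma psd_schur_complement:
  assumes "psd X" "X $ r $ r \<noteq> 0"
  shows "psd (schur_complement X r)"
  unfolding psd_def
proof (intro conjI allI)
  show "transpose (schur_complement X r) = schur_complement X r"
    by (auto simp: schur_complement_def transpose_def vec_eq_iff mult.commute
        psd_component_commute[OF assms(1)])
  fix x
  define c where "c = (X *v x) $ r / X $ r $ r"
  define y where "y = x - c *\<^sub>R axis r 1"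
  have S: "schur_complement X r *v x = X *v y"
    by (simp add: schur_complement_mult[OF assms(1)] y_def c_def)
  have "axis r 1 \<bullet> (X *v y) = 0"
    using schur_complement_mult_component[OF assms, of x] by (simp add: S inner_axis')
  then have "x \<bullet> (X *v y) = y \<bullet> (X *v y)"
    by (simp add: inner_diff_left y_def)
  then show "0 \<le> x \<bullet> (schur_complement X r *v x)"
    using psd_nonneg[OF assms(1), of y] by (simp add: S)
qed

text \<open>The range shrinks strictly: it lies in the range of \<open>X\<close> and in the
  hyperplane where coordinate \<open>r\<close> is 0, whereas column \<open>r\<close> of
  \<open>X\<close> is outside that hyperplane.\<close>

lemma rank_schur_complement_less:
  assumes "psd X" "X $ r $ r \<noteq> 0"
  shows "rank (schur_complement X r) < rank X"
proof -
  let ?S = "range ((*v) (schur_complement X r))" and ?R = "range ((*v) X)"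
  have sub: "?S \<subseteq> ?R"
    using schur_complement_mult[OF assms(1)] by auto
  have "X *v axis r 1 \<notin> ?S"
  proof
    assume "X *v axis r 1 \<in> ?S"
    then have "(X *v axis r 1) $ r = 0"
      using schur_complement_mult_component[OF assms] by auto
    then show False using assms(2) by (simp add: matrix_axis_component)
  qed
  then have "?S \<subset> ?R" using sub by blast
  moreover have "subspace ?S" "subspace ?R"
    by (auto intro!: linear_subspace_image)
  ultimately have "dim ?S < dim ?R"
    by (intro dim_psubset) (simp add: span_eq_iff[THEN iffD2])
  then show ?thesis by (simp add: rank_dim_range)
qed

text \<open>Cholesky elimination: each Schur complement lowers the rank bound by one and accounts
  for one coordinate of the vectors.\<close>

lemma psd_gram_factorization:
  assumes "psd X" "rank X \<le> m"
  shows "\<exists>u :: 'n::finite \<Rightarrow> nat \<Rightarrow> real. \<forall>i j. X $ i $ j = (\<Sum>l<m. u i l * u j l)"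
  using assms
proof (induction m arbitrary: X)
  case 0
  \<comment> \<open>A nonzero diagonal entry would allow the rank to drop below 0.\<close>
  have "X $ i $ i = 0" for i
    using rank_schur_complement_less[OF 0(1), of i] 0(2) by auto
  then show ?case using psd_zero_diag[OF 0(1)] by auto
next
  case (Suc m)
  show ?case
  proof (cases "\<exists>r. X $ r $ r \<noteq> 0")
    case False
    then show ?thesis
      using psd_zero_diag[OF Suc.prems(1)] by (intro exI[of _ "\<lambda>_ _. 0"]) simp
  next
    case True
    then obtain r where r: "X $ r $ r \<noteq> 0" by blast
    then have pos: "X $ r $ r > 0"
      using psd_diag_nonneg[OF Suc.prems(1), of r] by simp
    have "rank (schur_complement X r) \<le> m"
      using rank_schur_complement_less[OF Suc.prems(1) r] Suc.prems(2) by simp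
    from Suc.IH[OF psd_schur_complement[OF Suc.prems(1) r] this]
    obtain u :: "'n \<Rightarrow> nat \<Rightarrow> real"
      where u: "schur_complement X r $ i $ j = (\<Sum>l<m. u i l * u j l)" for i j
      by blast
    \<comment> \<open>The new coordinate \<open>m\<close> restores the rank-one term that the Schur
      complement subtracts.\<close>
    define v where "v i = (u i)(m := X $ i $ r / sqrt (X $ r $ r))" for i
    have "X $ i $ j = (\<Sum>l<Suc m. v i l * v j l)" for i j
    proof -
      have "(\<Sum>l<m. v i l * v j l) = (\<Sum>l<m. u i l * u j l)"
        by (rule sum.cong) (auto simp: v_def)
      also have "\<dots> = X $ i $ j - X $ i $ r * X $ j $ r / X $ r $ r"
        by (simp add: u[symmetric] schur_complement_def)
      finally show ?thesis using pos by (simp add: v_def)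
    qed
    then show ?thesis by blast
  qed
qed

lemma psd_gram_matrix:
  fixes p :: "'n::finite \<Rightarrow> nat \<Rightarrow> real"
  shows "psd (\<chi> i j. \<Sum>l<m. p i l * p j l)"
  unfolding psd_def
proof (intro conjI allI)
  show "transpose (\<chi> i j. \<Sum>l<m. p i l * p j l) = (\<chi> i j. \<Sum>l<m. p i l * p j l)"
    by (simp add: transpose_def vec_eq_iff mult.commute)
  fix x :: "real ^ 'n"
  have "x \<bullet> ((\<chi> i j. \<Sum>l<m. p i l * p j l) *v x) =
      (\<Sum>i\<in>UNIV. \<Sum>j\<in>UNIV. \<Sum>l<m. (x $ i * p i l) * (x $ j * p j l))"
    by (simp add: inner_vec_def matrix_vector_mult_def sum_distrib_left sum_distrib_right mult_ac)
  also have "\<dots> = (\<Sum>i\<in>UNIV. \<Sum>l<m. \<Sum>j\<in>UNIV. (x $ i * p i l) * (x $ j * p j l))"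
    by (intro sum.cong refl sum.swap)
  also have "\<dots> = (\<Sum>l<m. \<Sum>i\<in>UNIV. \<Sum>j\<in>UNIV. (x $ i * p i l) * (x $ j * p j l))"
    by (rule sum.swap)
  also have "\<dots> = (\<Sum>l<m. (\<Sum>i\<in>UNIV. x $ i * p i l)\<^sup>2)"
    by (simp add: power2_eq_square sum_product)
  finally show "0 \<le> x \<bullet> ((\<chi> i j. \<Sum>l<m. p i l * p j l) *v x)"
    by (simp add: sum_nonneg)
qed

section \<open>Squared distances read off a Gram matrix\<close>

definition gram_dist :: "real ^ 'n ^ 'n::finite \<Rightarrow> 'n \<Rightarrow> 'n \<Rightarrow> real" where
  "gram_dist X i j = X $ i $ i + X $ j $ j - 2 * X $ i $ j"

lemma sum_square_diff:
  fixes a b :: "'a \<Rightarrow> real"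
  shows "(\<Sum>l\<in>A. (a l - b l)\<^sup>2) =
    (\<Sum>l\<in>A. a l * a l) + (\<Sum>l\<in>A. b l * b l) - 2 * (\<Sum>l\<in>A. a l * b l)"
  by (simp add: power2_eq_square algebra_simps sum.distrib sum_subtractf sum_distrib_left)

text \<open>For Gram vectors \<open>u\<close>, the slack is the squared norm of
  \<open>u i + u j - 2 * u h\<close>, by the parallelogram law.\<close>

lemma gram_dist_triangle:
  assumes "psd X"
  shows "gram_dist X i j \<le> 2 * gram_dist X i h + 2 * gram_dist X h j"
proof -
  have "0 \<le> (axis i 1 + axis j 1 - 2 *\<^sub>R axis h 1) \<bullet>
      (X *v (axis i 1 + axis j 1 - 2 *\<^sub>R axis h 1))"
    by (rule psd_nonneg[OF assms])
  then show ?thesis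
    by (simp add: gram_dist_def matrix_vector_right_distrib matrix_vector_mult_diff_distrib
        matrix_vector_mult_scaleR inner_add_left inner_diff_left inner_axis' matrix_axis_component
        psd_component_commute[OF assms, of j i] psd_component_commute[OF assms, of h i]
        psd_component_commute[OF assms, of j h])
qed

text \<open>Induction along a walk from \<open>i\<close> to \<open>j\<close>. The point is that
  \<open>C\<close> is chosen before \<open>X\<close>, so it serves a whole sequence of
  matrices.\<close>

lemma gram_dist_bounded:
  assumes "(i, j) \<in> {(i, j). {i, j} \<in> E}\<^sup>*"
  shows "\<exists>C. \<forall>X. psd X \<longrightarrow> (\<forall>a b. {a, b} \<in> E \<longrightarrow> gram_dist X a b = d {a, b}) \<longrightarrow>
    gram_dist X i j \<le> C"
  using assms
proof (induction rule: rtrancl_induct)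
  case base
  show ?case by (auto simp: gram_dist_def)
next
  case (step h j)
  then obtain C where C: "\<And>X. psd X \<Longrightarrow>
      (\<forall>a b. {a, b} \<in> E \<longrightarrow> gram_dist X a b = d {a, b}) \<Longrightarrow> gram_dist X i h \<le> C"
    by blast
  show ?case
  proof (intro exI[of _ "2 * C + 2 * d {h, j}"] allI impI)
    fix X assume X: "psd X" "\<forall>a b. {a, b} \<in> E \<longrightarrow> gram_dist X a b = d {a, b}"
    have "gram_dist X h j = d {h, j}" using X(2) step.hyps by auto
    then show "gram_dist X i j \<le> 2 * C + 2 * d {h, j}"
      using C[OF X] gram_dist_triangle[OF X(1), of i j h] by linarith
  qed
qed

text \<open>Pythagoras: projecting away from \<open>u r\<close> removes the squared component of
  \<open>u i - u j\<close> along \<open>u r\<close>.\<close>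

lemma gram_dist_schur_complement:
  assumes "psd X"
  shows "gram_dist (schur_complement X r) i j =
    gram_dist X i j - (X $ i $ r - X $ j $ r)\<^sup>2 / X $ r $ r"
  by (simp add: gram_dist_def schur_complement_def power2_eq_square diff_divide_distrib
      algebra_simps add_divide_distrib)

section \<open>Compactness and limits of representations\<close>

text \<open>Bolzano-Weierstrass applied to one index at a time, refining the subsequence found so
  far.\<close>

lemma bounded_family_convergent_subseq:
  fixes f :: "'a \<Rightarrow> nat \<Rightarrow> real"
  assumes "finite S" "\<And>s. s \<in> S \<Longrightarrow> bounded (range (f s))"
  shows "\<exists>\<rho> :: nat \<Rightarrow> nat. strict_mono \<rho> \<and> (\<forall>s\<in>S. convergent (\<lambda>t. f s (\<rho> t)))"
  using assms
proof (induction S rule: finite_induct)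
  case empty
  show ?case by (auto intro: exI[of _ id] strict_mono_id)
next
  case (insert s S)
  then obtain \<rho> :: "nat \<Rightarrow> nat"
    where \<rho>: "strict_mono \<rho>" "\<And>s. s \<in> S \<Longrightarrow> convergent (\<lambda>t. f s (\<rho> t))"
    by auto
  have "bounded (range (\<lambda>t. f s (\<rho> t)))"
    using insert.prems[of s] by (rule bounded_subset) auto
  then obtain l \<sigma> where \<sigma>: "strict_mono \<sigma>" "((\<lambda>t. f s (\<rho> t)) \<circ> \<sigma>) \<longlonglongrightarrow> l"
    using bounded_imp_convergent_subsequence by blast
  have "convergent (\<lambda>t. f s' (\<rho> (\<sigma> t)))" if "s' \<in> insert s S" for s'
  proof (cases "s' = s")
    case True
    then show ?thesis using \<sigma>(2) by (auto simp: o_def convergent_def)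
  next
    case False
    then show ?thesis
      using convergent_subseq_convergent[OF \<rho>(2) \<sigma>(1), of s'] that by (simp add: o_def)
  qed
  moreover have "strict_mono (\<rho> \<circ> \<sigma>)" using \<rho>(1) \<sigma>(1) by (rule strict_mono_o)
  ultimately show ?case by (intro exI[of _ "\<rho> \<circ> \<sigma>"]) (simp add: o_def)
qed

lemma euclidean_rep_iff:
  "euclidean_rep E d k p \<longleftrightarrow>
    (\<forall>i l. k \<le> l \<longrightarrow> p i l = 0) \<and>
    (\<forall>i j. {i, j} \<in> E \<longrightarrow> (\<Sum>l<k. (p i l - p j l)\<^sup>2) = d {i, j})"
proof -
  have "(L2_set f {..<k})\<^sup>2 = (\<Sum>l<k. (f l)\<^sup>2)" for f :: "nat \<Rightarrow> real"
    by (simp add: L2_set_def sum_nonneg)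
  then show ?thesis by (simp add: euclidean_rep_def topspace_Euclidean_space)
qed

lemma euclidean_rep_limit:
  fixes w :: "nat \<Rightarrow> 'n::finite \<Rightarrow> nat \<Rightarrow> real"
  assumes bounded: "\<And>i l. l < m \<Longrightarrow> bounded (range (\<lambda>t. w t i l))"
    and lim: "\<And>i j. {i, j} \<in> E \<Longrightarrow> (\<lambda>t. \<Sum>l<m. (w t i l - w t j l)\<^sup>2) \<longlonglongrightarrow> d {i, j}"
  shows "\<exists>q. euclidean_rep E d m q"
proof -
  have "\<exists>\<rho> :: nat \<Rightarrow> nat. strict_mono \<rho> \<and>
      (\<forall>s\<in>UNIV \<times> {..<m}. convergent (\<lambda>t. (\<lambda>s t. w t (fst s) (snd s)) s (\<rho> t)))"
    by (rule bounded_family_convergent_subseq) (auto intro: bounded)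
  then obtain \<rho> :: "nat \<Rightarrow> nat" where \<rho>: "strict_mono \<rho>"
    and conv: "\<And>i l. l < m \<Longrightarrow> convergent (\<lambda>t. w (\<rho> t) i l)"
    by force
  define q where "q i l = (if l < m then lim (\<lambda>t. w (\<rho> t) i l) else 0)" for i l
  have q: "(\<lambda>t. w (\<rho> t) i l) \<longlonglongrightarrow> q i l" if "l < m" for i l
    using conv[OF that] that by (simp add: q_def convergent_LIMSEQ_iff)
  have "(\<Sum>l<m. (q i l - q j l)\<^sup>2) = d {i, j}" if "{i, j} \<in> E" for i j
  proof (rule LIMSEQ_unique)
    show "(\<lambda>t. \<Sum>l<m. (w (\<rho> t) i l - w (\<rho> t) j l)\<^sup>2) \<longlonglongrightarrow> (\<Sum>l<m. (q i l - q j l)\<^sup>2)"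
      by (intro tendsto_intros q) auto
    show "(\<lambda>t. \<Sum>l<m. (w (\<rho> t) i l - w (\<rho> t) j l)\<^sup>2) \<longlonglongrightarrow> d {i, j}"
      using LIMSEQ_subseq_LIMSEQ[OF lim[OF that] \<rho>] by (simp add: o_def)
  qed
  then have "euclidean_rep E d m q"
    by (simp add: euclidean_rep_iff) (simp add: q_def)
  then show ?thesis by blast
qed

section \<open>Lifting, projecting and passing to the limit\<close>

lemma euclidean_rep_gram_dim:
  fixes E :: "'n::finite set set"
  assumes "euclidean_rep E d m p"
  shows "\<exists>q. euclidean_rep E d (gram_dim E - 1) q"
proof -
  define k where "k = gram_dim E"
  have k: "1 \<le> k" "\<And>X :: real ^ 'n ^ 'n. psd X \<Longrightarrow>
       (\<exists>X' :: real ^ 'n ^ 'n. psd X' \<and> rank X' \<le> k \<and>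
          (\<forall>i. X' $ i $ i = X $ i $ i) \<and>
          (\<forall>i j. {i, j} \<in> E \<longrightarrow> X' $ i $ j = X $ i $ j))"
    using LeastI_ex[OF gram_dim_wellposed[of E]]
    unfolding k_def gram_dim_def by blast+
  define g where "g i j = (\<Sum>l<m. p i l * p j l)" for i j
  have g_nonneg: "0 \<le> g i i" for i by (simp add: g_def sum_nonneg)
  have g_dist: "g i i + g j j - 2 * g i j = d {i, j}" if "{i, j} \<in> E" for i j
    using assms that
    by (simp add: euclidean_rep_iff g_def sum_square_diff)
  define T where "T t = real (Suc t)" for t
  have T_pos: "T t > 0" for t by (simp add: T_def)

  have "\<exists>X :: real ^ 'n ^ 'n. psd X \<and> rank X \<le> k \<and> (\<forall>i. X $ i $ i = g i i + (T t)\<^sup>2) \<and>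
      (\<forall>i j. {i, j} \<in> E \<longrightarrow> gram_dist X i j = d {i, j})" for t
  proof -
    \<comment> \<open>Coordinate \<open>m\<close> holds the common height, so every Gram entry grows
      by \<open>(T t)\<^sup>2\<close> and all distances stay the same.\<close>
    define P where "P i = (p i)(m := T t)" for i
    have P: "(\<Sum>l<Suc m. P i l * P j l) = g i j + (T t)\<^sup>2" for i j
    proof -
      have "(\<Sum>l<m. P i l * P j l) = g i j"
        unfolding g_def by (rule sum.cong) (auto simp: P_def)
      then show ?thesis by (simp add: P_def power2_eq_square)
    qed
    from k(2)[OF psd_gram_matrix[of P "Suc m"]] obtain X :: "real ^ 'n ^ 'n"
      where X: "psd X" "rank X \<le> k" "\<And>i. X $ i $ i = g i i + (T t)\<^sup>2"
        "\<And>i j. {i, j} \<in> E \<Longrightarrow> X $ i $ j = g i j + (T t)\<^sup>2"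
      unfolding P by auto
    then show ?thesis
      by (intro exI[of _ X]) (auto simp: gram_dist_def g_dist[symmetric])
  qed
  then obtain X :: "nat \<Rightarrow> real ^ 'n ^ 'n" where psd: "\<And>t. psd (X t)" and rank: "\<And>t. rank (X t) \<le> k"
    and diag: "\<And>t i. X t $ i $ i = g i i + (T t)\<^sup>2"
    and edge: "\<And>t i j. {i, j} \<in> E \<Longrightarrow> gram_dist (X t) i j = d {i, j}"
    by metis
  have diag_pos: "X t $ i $ i > 0" for t i
    using g_nonneg[of i] T_pos[of t] by (simp add: diag add_nonneg_pos)

  define A where "A = {(i, j). {i, j} \<in> E}"
  have "sym (A\<^sup>*)"
    by (rule sym_rtrancl) (auto simp: sym_def A_def insert_commute)
  \<comment> \<open>Vertices of one component reach the same set of vertices, so \<open>SOME\<close>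
    picks the same root for all of them.\<close>
  define root where "root i = (SOME r. (i, r) \<in> A\<^sup>*)" for i
  have root: "(i, root i) \<in> A\<^sup>*" for i
    unfolding root_def by (rule someI[of _ i]) simp
  have root_eq: "root i = root j" if "{i, j} \<in> E" for i j
  proof -
    have ij: "(i, j) \<in> A\<^sup>*" using that by (auto simp: A_def)
    then have ji: "(j, i) \<in> A\<^sup>*" using \<open>sym (A\<^sup>*)\<close> by (auto dest: symD)
    have "(\<lambda>r. (i, r) \<in> A\<^sup>*) = (\<lambda>r. (j, r) \<in> A\<^sup>*)"
      using rtrancl_trans[OF ij] rtrancl_trans[OF ji] by blast
    then show ?thesis by (simp add: root_def)
  qed
  have "\<forall>i. \<exists>C. \<forall>t. gram_dist (X t) i (root i) \<le> C"
    using gram_dist_bounded[OF root[unfolded A_def], where d = d] psd edge by meson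
  then obtain C where C: "\<And>i t. gram_dist (X t) i (root i) \<le> C i" by metis

  define Y where "Y t r = schur_complement (X t) r" for t r
  \<comment> \<open>The rank lost in the Schur complement is the dimension saved.\<close>
  have "\<exists>u :: 'n \<Rightarrow> nat \<Rightarrow> real. \<forall>i j. Y t r $ i $ j = (\<Sum>l<k - 1. u i l * u j l)" for t r
  proof (rule psd_gram_factorization)
    have "X t $ r $ r \<noteq> 0" using diag_pos[of t r] by simp
    then show "psd (Y t r)" "rank (Y t r) \<le> k - 1"
      using psd_schur_complement[OF psd] rank_schur_complement_less[OF psd, of t r] rank[of t]
      by (auto simp: Y_def)
  qed
  then obtain u :: "nat \<Rightarrow> 'n \<Rightarrow> 'n \<Rightarrow> nat \<Rightarrow> real"
    where u: "\<And>t r i j. Y t r $ i $ j = (\<Sum>l<k - 1. u t r i l * u t r j l)"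
    by metis
  have u_dist: "(\<Sum>l<k - 1. (u t r i l - u t r j l)\<^sup>2) =
      gram_dist (X t) i j - (X t $ i $ r - X t $ j $ r)\<^sup>2 / X t $ r $ r" for t r i j
    unfolding sum_square_diff u[symmetric]
    using gram_dist_schur_complement[OF psd, of t r i j] by (simp add: Y_def gram_dist_def)
  \<comment> \<open>Each vertex is taken from the projection at its own root; the ends of an edge
    share a root, so their difference lives in a single projection.\<close>
  define w where "w t i = u t (root i) i" for t i

  have "\<exists>q. euclidean_rep E d (k - 1) q"
  proof (rule euclidean_rep_limit)
    fix i l assume l: "l < k - 1"
    have "\<bar>w t i l\<bar> \<le> sqrt (C i)" for t
    proof -
      let ?r = "root i"
      \<comment> \<open>The root is projected to the origin, so the norm of \<open>w t i\<close> is
        a projected distance to the root, which is at most the distance before projection.\<close>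
      have "(\<Sum>l<k - 1. u t ?r ?r l * u t ?r ?r l) = 0"
        unfolding u[symmetric] using diag_pos[of t ?r] by (simp add: Y_def schur_complement_def)
      then have zero: "u t ?r ?r l = 0" if "l < k - 1" for l
        using that by (subst (asm) sum_nonneg_eq_0_iff) auto
      have "(w t i l)\<^sup>2 \<le> (\<Sum>l<k - 1. (u t ?r i l)\<^sup>2)"
        unfolding w_def using l by (intro member_le_sum) auto
      also have "\<dots> = (\<Sum>l<k - 1. (u t ?r i l - u t ?r ?r l)\<^sup>2)"
        by (rule sum.cong) (auto simp: zero)
      also have "\<dots> \<le> C i"
        using C[of t i] diag_pos[of t ?r] unfolding u_dist
        by (smt (verit) divide_nonneg_pos zero_le_power2)
      finally show ?thesis by (rule real_le_rsqrt[of "\<bar>w t i l\<bar>", simplified])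
    qed
    then show "bounded (range (\<lambda>t. w t i l))"
      by (auto simp: bounded_iff)
  next
    fix i j assume ij: "{i, j} \<in> E"
    define r where "r = root i"
    \<comment> \<open>\<open>K\<close> does not depend on \<open>t\<close>: in the difference of the
      squared norms of \<open>i\<close> and \<open>j\<close> the heights cancel, and the distances
      to the root are bounded by \<open>C\<close>.\<close>
    define K where "K = \<bar>g i i - g j j\<bar> + C i + C j"
    have bound: "\<bar>(\<Sum>l<k - 1. (w t i l - w t j l)\<^sup>2) - d {i, j}\<bar> \<le> K\<^sup>2 / (T t)\<^sup>2" for t
    proof -
      have nonneg: "0 \<le> gram_dist (X t) a b" for a b
        \<comment> \<open>The walk from \<open>a\<close> to \<open>b\<close> and back to
          \<open>a\<close> gives \<open>0 \<le> 4 * gram_dist (X t) a b\<close>.\<close>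
        using gram_dist_triangle[OF psd, of t a a b]
        by (simp add: gram_dist_def psd_component_commute[OF psd, of t b a])
      have "2 * (X t $ i $ r - X t $ j $ r) =
          g i i - g j j - gram_dist (X t) i r + gram_dist (X t) j r"
        by (simp add: gram_dist_def diag)
      moreover have "gram_dist (X t) i r \<le> C i" "gram_dist (X t) j r \<le> C j"
        using C[of t i] C[of t j] root_eq[OF ij] by (simp_all add: r_def)
      ultimately have "\<bar>X t $ i $ r - X t $ j $ r\<bar> \<le> K"
        using nonneg[of i r] nonneg[of j r] unfolding K_def by (smt (verit))
      then have "(X t $ i $ r - X t $ j $ r)\<^sup>2 \<le> K\<^sup>2"
        by (metis abs_ge_zero power2_abs power_mono)
      moreover have "(T t)\<^sup>2 \<le> X t $ r $ r" using g_nonneg[of r] by (simp add: diag)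
      ultimately have "(X t $ i $ r - X t $ j $ r)\<^sup>2 / X t $ r $ r \<le> K\<^sup>2 / (T t)\<^sup>2"
        using T_pos[of t] by (intro frac_le) auto
      moreover have "(\<Sum>l<k - 1. (w t i l - w t j l)\<^sup>2) =
          d {i, j} - (X t $ i $ r - X t $ j $ r)\<^sup>2 / X t $ r $ r"
        using u_dist[where t = t and r = r and i = i and j = j] root_eq[OF ij]
        by (simp add: w_def r_def edge[OF ij])
      moreover have "0 \<le> (X t $ i $ r - X t $ j $ r)\<^sup>2 / X t $ r $ r"
        using diag_pos[of t r] by simp
      ultimately show ?thesis by simp
    qed
    have "(\<lambda>t. K\<^sup>2 / (T t)\<^sup>2) \<longlonglongrightarrow> 0"
      using tendsto_mult[OF tendsto_const[of "K\<^sup>2"] tendsto_power[OF LIMSEQ_inverse_real_of_nat, of 2]]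
      by (simp add: T_def divide_inverse power_inverse)
    then have "(\<lambda>t. (\<Sum>l<k - 1. (w t i l - w t j l)\<^sup>2) - d {i, j}) \<longlonglongrightarrow> 0"
      by (rule Lim_null_comparison[rotated]) (use bound in auto)
    then show "(\<lambda>t. \<Sum>l<k - 1. (w t i l - w t j l)\<^sup>2) \<longlonglongrightarrow> d {i, j}"
      by (rule LIM_zero_cancel)
  qed
  then show ?thesis by (simp add: k_def)
qed

section \<open>Passage to the maximum over all edge vectors\<close>

lemma gram_dim_ge_1: "1 \<le> gram_dim E"
  using LeastI_ex[OF gram_dim_wellposed[of E]] unfolding gram_dim_def by blast

lemma EDM_nonempty: "EDM E \<noteq> {}"
proof -
  have "restrict (\<lambda>_. 0) E \<in> EDM E"
    by (auto simp: EDM_def euclidean_rep_iff intro!: exI[of _ 0] exI[of _ "\<lambda>_ _. 0"])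
  then show ?thesis by blast
qed

theorem theorem6:
  fixes E :: "'n::finite set set"
  assumes "simple_graph E"
  shows "int (euclid_dim E) \<le> int (gram_dim E) - 1"
proof -
  have le: "euclid_dim_at E d \<le> gram_dim E - 1" if d: "d \<in> EDM E" for d
  proof -
    obtain m p where "euclidean_rep E d m p" using d by (auto simp: EDM_def)
    then show ?thesis
      unfolding euclid_dim_at_def by (intro Least_le euclidean_rep_gram_dim)
  qed
  \<comment> \<open>\<open>Max\<close> is only informative on a finite nonempty set; the uniform
    bound makes this set of naturals finite.\<close>
  then have "finite (euclid_dim_at E ` EDM E)"
    by (intro finite_subset[OF _ finite_atMost[of "gram_dim E - 1"]]) auto
  then have "euclid_dim E \<le> gram_dim E - 1"
    unfolding euclid_dim_def using le EDM_nonempty[of E] by (subst Max_le_iff) auto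
  \<comment> \<open>Since the Gram dimension is at least 1, the truncated subtraction agrees with
    the integer one.\<close>
  then show ?thesis using gram_dim_ge_1[of E] by linarith
qed

end
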